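(* Let $t_0<T$ be real numbers, $n$ a positive integer, and let $\phi(t,s,v)$ be a continuous function of $t_0\le s\le t\le T$ and $v\in\mathbb{R}^n$, with values in $\mathbb{R}^n$. Assume that $\phi$ satisfies a uniform Lipschitz condition in $v$: there exists $\lambda\in\mathbb{R}$ such that $\lVert\phi(t,s,v)-\phi(t,s,\tilde v)\rVert\le\lambda\lVert v-\tilde v\rVert$ for all $t_0\le s\le t\le T$ and all $v,\tilde v\in\mathbb{R}^n$. Let $L^2([t_0,T],n)$ be the Hilbert space of square-integrable functions $[t_0,T]\to\mathbb{R}^n$. Then the nonlinear map $f\colon L^2([t_0,T],n)\to L^2([t_0,T],n)$ given by $$f(u)(t)=\int_{t_0}^t\phi(t,s,u(s))\,ds,\qquad t\in[t_0,T],$$ is a machine on $L^2([t_0,T],n)$.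
   Context: $\mathbb{R}^n$ carries the standard scalar product and Euclidean norm, and $L^2([t_0,T],n)$ its norm topology. A continuous (not necessarily linear) map $f\colon M\to M$ on a topological vector space $M$ is a machine if, for every topological space $X$ and every continuous map $g\colon X\to M$, there exists a unique continuous map $h\colon X\to M$ such that $h=g+f\circ h$ (pointwise sum). *)

theory Defs
  imports "HOL-Analysis.Analysis"
begin

section \<open>Topological vector spaces with an explicit carrier, and machines\<close>

text \<open>
  The carrier is the underlying set of the topology \<open>M\<close>, so that spaces depending on parameters
  (such as the endpoints of an interval) are covered.
\<close>

locale topological_vector_space =
  fixes M :: "'m topology" and add :: "'m \<Rightarrow> 'm \<Rightarrow> 'm"
    and zero :: 'm and scale :: "real \<Rightarrow> 'm \<Rightarrow> 'm"
  assumes add_assoc: "\<lbrakk>x \<in> topspace M; y \<in> topspace M; z \<in> topspace M\<rbrakk>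
      \<Longrightarrow> add (add x y) z = add x (add y z)"
    and add_commute: "\<lbrakk>x \<in> topspace M; y \<in> topspace M\<rbrakk> \<Longrightarrow> add x y = add y x"
    and zero_closed: "zero \<in> topspace M"
    and add_zero: "x \<in> topspace M \<Longrightarrow> add x zero = x"
    and add_scale_minus_one: "x \<in> topspace M \<Longrightarrow> add x (scale (-1) x) = zero"
    and scale_one: "x \<in> topspace M \<Longrightarrow> scale 1 x = x"
    and scale_scale: "x \<in> topspace M \<Longrightarrow> scale c (scale d x) = scale (c * d) x"
    and scale_add_left: "x \<in> topspace M \<Longrightarrow> scale (c + d) x = add (scale c x) (scale d x)"
    and scale_add_right: "\<lbrakk>x \<in> topspace M; y \<in> topspace M\<rbrakk>
      \<Longrightarrow> scale c (add x y) = add (scale c x) (scale c y)"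
    and continuous_add: "continuous_map (prod_topology M M) M (\<lambda>(x, y). add x y)"
    and continuous_scale: "continuous_map (prod_topology euclideanreal M) M (\<lambda>(c, x). scale c x)"
begin

text \<open>
  Quantification over types is impossible inside a definition, so the type carrying the test
  spaces \<open>X\<close> is a parameter, to be left as a free type variable in theorems.  The condition
  \<open>h \<in> extensional (topspace X)\<close> only normalises the values of \<open>h\<close> outside the space \<open>X\<close>, without
  which uniqueness of a total function would be meaningless.
\<close>

definition machine :: "'x itself \<Rightarrow> ('m \<Rightarrow> 'm) \<Rightarrow> bool" where
  "machine _ f \<longleftrightarrow> continuous_map M M f \<and>
     (\<forall>(X :: 'x topology) g. continuous_map X M g \<longrightarrow>
        (\<exists>!h. h \<in> extensional (topspace X) \<and> continuous_map X M h \<and>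
              (\<forall>x \<in> topspace X. h x = add (g x) (f (h x)))))"

end

section \<open>The Hilbert space of square-integrable functions\<close>

definition L2_fun :: "'a measure \<Rightarrow> ('a \<Rightarrow> 'b::euclidean_space) set" where
  "L2_fun M = {u. u \<in> borel_measurable M \<and> integrable M (\<lambda>x. (norm (u x))\<^sup>2)}"

definition L2_rel :: "'a measure \<Rightarrow> (('a \<Rightarrow> 'b::euclidean_space) \<times> ('a \<Rightarrow> 'b)) set" where
  "L2_rel M = {(u, v). u \<in> L2_fun M \<and> v \<in> L2_fun M \<and> (AE x in M. u x = v x)}"

definition L2_space :: "'a measure \<Rightarrow> ('a \<Rightarrow> 'b::euclidean_space) set set" where
  "L2_space M = L2_fun M // L2_rel M"

definition L2_class :: "'a measure \<Rightarrow> ('a \<Rightarrow> 'b::euclidean_space) \<Rightarrow> ('a \<Rightarrow> 'b) set" where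
  "L2_class M u = L2_rel M `` {u}"

text \<open>
  An arbitrary representative; the operations below do not depend on this choice, see
  \<open>L2_add_class\<close>, \<open>L2_scale_class\<close>, \<open>L2_inner_class\<close> and \<open>L2_dist_eq_norm\<close>.
\<close>

definition L2_rep :: "('a \<Rightarrow> 'b::euclidean_space) set \<Rightarrow> 'a \<Rightarrow> 'b" where
  "L2_rep U = (SOME u. u \<in> U)"

definition L2_zero :: "'a measure \<Rightarrow> ('a \<Rightarrow> 'b::euclidean_space) set" where
  "L2_zero M = L2_class M (\<lambda>_. 0)"

definition L2_add :: "'a measure \<Rightarrow> ('a \<Rightarrow> 'b::euclidean_space) set \<Rightarrow> ('a \<Rightarrow> 'b) set \<Rightarrow> ('a \<Rightarrow> 'b) set"
  where "L2_add M U V = L2_class M (\<lambda>x. L2_rep U x + L2_rep V x)"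

definition L2_scale :: "'a measure \<Rightarrow> real \<Rightarrow> ('a \<Rightarrow> 'b::euclidean_space) set \<Rightarrow> ('a \<Rightarrow> 'b) set"
  where "L2_scale M c U = L2_class M (\<lambda>x. c *\<^sub>R L2_rep U x)"

definition L2_inner :: "'a measure \<Rightarrow> ('a \<Rightarrow> 'b::euclidean_space) set \<Rightarrow> ('a \<Rightarrow> 'b) set \<Rightarrow> real"
  where "L2_inner M U V = (LINT x|M. L2_rep U x \<bullet> L2_rep V x)"

definition L2_norm :: "'a measure \<Rightarrow> ('a \<Rightarrow> 'b::euclidean_space) set \<Rightarrow> real"
  where "L2_norm M U = sqrt (L2_inner M U U)"

definition L2_dist :: "'a measure \<Rightarrow> ('a \<Rightarrow> 'b::euclidean_space) set \<Rightarrow> ('a \<Rightarrow> 'b) set \<Rightarrow> real"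
  where "L2_dist M U V = sqrt (LINT x|M. (norm (L2_rep U x - L2_rep V x))\<^sup>2)"

definition L2_topology :: "'a measure \<Rightarrow> ('a \<Rightarrow> 'b::euclidean_space) set topology"
  where "L2_topology M = Metric_space.mtopology (L2_space M) (L2_dist M)"

subsection \<open>Square-integrable functions\<close>

lemma L2_fun_inner_integrable:
  assumes "u \<in> L2_fun M" "v \<in> L2_fun M"
  shows "integrable M (\<lambda>x. u x \<bullet> v x)"
proof (rule Bochner_Integration.integrable_bound)
  show "integrable M (\<lambda>x. (norm (u x))\<^sup>2 + (norm (v x))\<^sup>2)"
    using assms by (simp add: L2_fun_def)
  show "(\<lambda>x. u x \<bullet> v x) \<in> borel_measurable M"
    using assms by (simp add: L2_fun_def borel_measurable_inner)
  have "norm (u x \<bullet> v x) \<le> norm ((norm (u x))\<^sup>2 + (norm (v x))\<^sup>2)" for x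
  proof -
    have "\<bar>u x \<bullet> v x\<bar> \<le> norm (u x) * norm (v x)" by (rule Cauchy_Schwarz_ineq2)
    also have "\<dots> \<le> 2 * (norm (u x) * norm (v x))" by simp
    also have "\<dots> \<le> (norm (u x))\<^sup>2 + (norm (v x))\<^sup>2"
      using sum_squares_bound[of "norm (u x)" "norm (v x)"] by simp
    finally show ?thesis by simp
  qed
  then show "AE x in M. norm (u x \<bullet> v x) \<le> norm ((norm (u x))\<^sup>2 + (norm (v x))\<^sup>2)"
    by simp
qed

lemma L2_fun_add:
  assumes "u \<in> L2_fun M" "v \<in> L2_fun M"
  shows "(\<lambda>x. u x + v x) \<in> L2_fun M"
proof -
  have "(\<lambda>x. (norm (u x + v x))\<^sup>2) = (\<lambda>x. u x \<bullet> u x + 2 * (u x \<bullet> v x) + v x \<bullet> v x)"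
    by (auto simp: power2_norm_eq_inner inner_add inner_commute)
  then have "integrable M (\<lambda>x. (norm (u x + v x))\<^sup>2)"
    using assms by (simp add: L2_fun_inner_integrable)
  then show ?thesis using assms by (simp add: L2_fun_def borel_measurable_add)
qed

lemma L2_fun_scale: "u \<in> L2_fun M \<Longrightarrow> (\<lambda>x. c *\<^sub>R u x) \<in> L2_fun M"
  by (simp add: L2_fun_def power_mult_distrib borel_measurable_scaleR)

lemma L2_fun_zero: "(\<lambda>_. 0) \<in> L2_fun M"
  by (simp add: L2_fun_def)

subsection \<open>Independence of representatives\<close>

lemma L2_equiv: "equiv (L2_fun M) (L2_rel M)"
proof (rule equivI)
  show "L2_rel M \<subseteq> L2_fun M \<times> L2_fun M" by (auto simp: L2_rel_def)
  show "refl_on (L2_fun M) (L2_rel M)" by (auto simp: refl_on_def L2_rel_def)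
  show "sym (L2_rel M)" by (auto simp: sym_def L2_rel_def elim: eventually_mono)
  show "trans (L2_rel M)" 
    unfolding trans_def L2_rel_def by (auto elim: AE_mp)
qed

lemma L2_class_eq_iff:
  assumes "u \<in> L2_fun M" "v \<in> L2_fun M"
  shows "L2_class M u = L2_class M v \<longleftrightarrow> (AE x in M. u x = v x)"
  using eq_equiv_class_iff[OF L2_equiv assms] assms by (simp add: L2_class_def L2_rel_def)

lemma L2_class_in_space: "u \<in> L2_fun M \<Longrightarrow> L2_class M u \<in> L2_space M"
  by (simp add: L2_class_def L2_space_def quotientI)

lemma L2_space_cases:
  assumes "U \<in> L2_space M"
  obtains u where "u \<in> L2_fun M" "U = L2_class M u"
  using assms by (auto simp: L2_space_def L2_class_def elim: quotientE)

lemma L2_in_class_iff: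
  "v \<in> L2_class M u \<longleftrightarrow> u \<in> L2_fun M \<and> v \<in> L2_fun M \<and> (AE x in M. u x = v x)"
  by (simp add: L2_class_def L2_rel_def)

lemma L2_rep_class:
  assumes "u \<in> L2_fun M"
  shows "L2_rep (L2_class M u) \<in> L2_fun M" "AE x in M. L2_rep (L2_class M u) x = u x"
proof -
  have "u \<in> L2_class M u"
    using assms by (simp add: L2_in_class_iff)
  then have "L2_rep (L2_class M u) \<in> L2_class M u"
    unfolding L2_rep_def by (rule someI[where P = "\<lambda>v. v \<in> L2_class M u"])
  then show "L2_rep (L2_class M u) \<in> L2_fun M" "AE x in M. L2_rep (L2_class M u) x = u x"
    by (auto simp: L2_in_class_iff elim: eventually_mono)
qed

lemma L2_add_class:
  assumes "u \<in> L2_fun M" "v \<in> L2_fun M"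
  shows "L2_add M (L2_class M u) (L2_class M v) = L2_class M (\<lambda>x. u x + v x)"
proof -
  have "AE x in M. L2_rep (L2_class M u) x + L2_rep (L2_class M v) x = u x + v x"
    using L2_rep_class(2)[OF assms(1)] L2_rep_class(2)[OF assms(2)] by eventually_elim simp
  then show ?thesis
    unfolding L2_add_def using assms by (simp add: L2_class_eq_iff L2_fun_add L2_rep_class(1))
qed

lemma L2_scale_class:
  assumes "u \<in> L2_fun M"
  shows "L2_scale M c (L2_class M u) = L2_class M (\<lambda>x. c *\<^sub>R u x)"
proof -
  have "AE x in M. c *\<^sub>R L2_rep (L2_class M u) x = c *\<^sub>R u x"
    using L2_rep_class(2)[OF assms(1)] by eventually_elim simp
  then show ?thesis
    unfolding L2_scale_def using assms by (simp add: L2_class_eq_iff L2_fun_scale L2_rep_class(1))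
qed

lemma L2_inner_class:
  assumes "u \<in> L2_fun M" "v \<in> L2_fun M"
  shows "L2_inner M (L2_class M u) (L2_class M v) = (LINT x|M. u x \<bullet> v x)"
  unfolding L2_inner_def
proof (rule integral_cong_AE)
  show "(\<lambda>x. L2_rep (L2_class M u) x \<bullet> L2_rep (L2_class M v) x) \<in> borel_measurable M"
    using L2_rep_class(1)[OF assms(1)] L2_rep_class(1)[OF assms(2)]
    by (simp add: L2_fun_def borel_measurable_inner)
  show "(\<lambda>x. u x \<bullet> v x) \<in> borel_measurable M"
    using assms by (simp add: L2_fun_def borel_measurable_inner)
  show "AE x in M. L2_rep (L2_class M u) x \<bullet> L2_rep (L2_class M v) x = u x \<bullet> v x"
    using L2_rep_class(2)[OF assms(1)] L2_rep_class(2)[OF assms(2)] by eventually_elim simp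
qed

subsection \<open>The vector space operations and the norm\<close>

lemma L2_zero_in_space: "L2_zero M \<in> L2_space M"
  by (simp add: L2_zero_def L2_class_in_space L2_fun_zero)

lemma L2_add_in_space: "\<lbrakk>U \<in> L2_space M; V \<in> L2_space M\<rbrakk> \<Longrightarrow> L2_add M U V \<in> L2_space M"
  by (auto elim!: L2_space_cases simp: L2_add_class L2_class_in_space L2_fun_add)

lemma L2_scale_in_space: "U \<in> L2_space M \<Longrightarrow> L2_scale M c U \<in> L2_space M"
  by (auto elim!: L2_space_cases simp: L2_scale_class L2_class_in_space L2_fun_scale)

lemmas L2_class_simps = L2_zero_def L2_add_class L2_scale_class L2_inner_class
  L2_fun_add L2_fun_scale L2_fun_zero

lemma L2_add_assoc:
  "\<lbrakk>U \<in> L2_space M; V \<in> L2_space M; W \<in> L2_space M\<rbrakk>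
    \<Longrightarrow> L2_add M (L2_add M U V) W = L2_add M U (L2_add M V W)"
  by (auto elim!: L2_space_cases simp: L2_class_simps add.assoc)

lemma L2_add_commute:
  "\<lbrakk>U \<in> L2_space M; V \<in> L2_space M\<rbrakk> \<Longrightarrow> L2_add M U V = L2_add M V U"
  by (auto elim!: L2_space_cases simp: L2_class_simps add.commute)

lemma L2_add_zero: "U \<in> L2_space M \<Longrightarrow> L2_add M U (L2_zero M) = U"
  by (auto elim!: L2_space_cases simp: L2_class_simps)

lemma L2_add_minus:
  assumes "U \<in> L2_space M"
  shows "L2_add M U (L2_scale M (-1) U) = L2_zero M"
proof -
  obtain u where u: "u \<in> L2_fun M" "U = L2_class M u"
    using assms by (rule L2_space_cases)
  have "L2_add M U (L2_scale M (-1) U) = L2_class M (\<lambda>x. u x + (-1) *\<^sub>R u x)"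
    unfolding u(2) L2_scale_class[OF u(1)] by (intro L2_add_class u(1) L2_fun_scale)
  then show ?thesis by (simp add: L2_zero_def)
qed

lemma L2_scale_one: "U \<in> L2_space M \<Longrightarrow> L2_scale M 1 U = U"
  by (auto elim!: L2_space_cases simp: L2_class_simps)

lemma L2_scale_scale:
  "U \<in> L2_space M \<Longrightarrow> L2_scale M c (L2_scale M d U) = L2_scale M (c * d) U"
  by (auto elim!: L2_space_cases simp: L2_class_simps)

lemma L2_scale_add_left:
  "U \<in> L2_space M \<Longrightarrow> L2_scale M (c + d) U = L2_add M (L2_scale M c U) (L2_scale M d U)"
  by (auto elim!: L2_space_cases simp: L2_class_simps scaleR_add_left)

lemma L2_scale_add_right:
  "\<lbrakk>U \<in> L2_space M; V \<in> L2_space M\<rbrakk>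
    \<Longrightarrow> L2_scale M c (L2_add M U V) = L2_add M (L2_scale M c U) (L2_scale M c V)"
  by (auto elim!: L2_space_cases simp: L2_class_simps scaleR_add_right)

lemma L2_inner_add_left:
  "\<lbrakk>U \<in> L2_space M; V \<in> L2_space M; W \<in> L2_space M\<rbrakk>
    \<Longrightarrow> L2_inner M (L2_add M U V) W = L2_inner M U W + L2_inner M V W"
  by (auto elim!: L2_space_cases simp: L2_class_simps inner_add_left L2_fun_inner_integrable)

lemma L2_inner_scale_left:
  "\<lbrakk>U \<in> L2_space M; V \<in> L2_space M\<rbrakk>
    \<Longrightarrow> L2_inner M (L2_scale M c U) V = c * L2_inner M U V"
  by (auto elim!: L2_space_cases simp: L2_class_simps)

lemma L2_inner_commute: "L2_inner M U V = L2_inner M V U"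
  by (simp add: L2_inner_def inner_commute)

lemma L2_inner_scale_right:
  "\<lbrakk>U \<in> L2_space M; V \<in> L2_space M\<rbrakk>
    \<Longrightarrow> L2_inner M U (L2_scale M c V) = c * L2_inner M U V"
  by (metis L2_inner_commute L2_inner_scale_left)

lemma L2_inner_add_right:
  "\<lbrakk>U \<in> L2_space M; V \<in> L2_space M; W \<in> L2_space M\<rbrakk>
    \<Longrightarrow> L2_inner M U (L2_add M V W) = L2_inner M U V + L2_inner M U W"
  by (metis L2_inner_commute L2_inner_add_left)

lemma L2_inner_self_nonneg: "0 \<le> L2_inner M U U"
  by (simp add: L2_inner_def)

lemma L2_inner_self_eq_0:
  assumes "U \<in> L2_space M"
  shows "L2_inner M U U = 0 \<longleftrightarrow> U = L2_zero M"
proof -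
  obtain u where u: "u \<in> L2_fun M" "U = L2_class M u"
    using assms by (rule L2_space_cases)
  have "L2_inner M U U = 0 \<longleftrightarrow> (AE x in M. u x \<bullet> u x = 0)"
    using integral_nonneg_eq_0_iff_AE[OF L2_fun_inner_integrable[OF u(1) u(1)]] u
    by (simp add: L2_inner_class)
  also have "\<dots> \<longleftrightarrow> U = L2_zero M"
    using u by (simp add: L2_zero_def L2_class_eq_iff L2_fun_zero)
  finally show ?thesis .
qed

lemma L2_norm_nonneg: "0 \<le> L2_norm M U"
  by (simp add: L2_norm_def L2_inner_self_nonneg)

lemma L2_norm_power2: "(L2_norm M U)\<^sup>2 = L2_inner M U U"
  by (simp add: L2_norm_def L2_inner_self_nonneg)

lemma L2_norm_eq_0: "U \<in> L2_space M \<Longrightarrow> L2_norm M U = 0 \<longleftrightarrow> U = L2_zero M"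
  by (simp add: L2_norm_def L2_inner_self_eq_0)

lemma L2_norm_scale:
  assumes "U \<in> L2_space M"
  shows "L2_norm M (L2_scale M c U) = \<bar>c\<bar> * L2_norm M U"
proof -
  have "L2_inner M (L2_scale M c U) (L2_scale M c U) = c\<^sup>2 * L2_inner M U U"
    using assms
    by (simp add: L2_inner_scale_left L2_inner_scale_right L2_scale_in_space power2_eq_square)
  then show ?thesis by (simp add: L2_norm_def real_sqrt_mult)
qed

lemma L2_inner_add_square:
  assumes "U \<in> L2_space M" "V \<in> L2_space M"
  shows "L2_inner M (L2_add M U V) (L2_add M U V)
    = L2_inner M U U + 2 * L2_inner M U V + L2_inner M V V"
  using assms L2_inner_commute[of M V U]
  by (simp add: L2_inner_add_left L2_inner_add_right L2_add_in_space)

lemma L2_Cauchy_Schwarz: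
  assumes U: "U \<in> L2_space M" and V: "V \<in> L2_space M"
  shows "L2_inner M U V \<le> L2_norm M U * L2_norm M V"
proof -
  let ?a = "L2_norm M U" and ?b = "L2_norm M V"
  have sq: "0 \<le> c\<^sup>2 * ?a\<^sup>2 + 2 * c * d * L2_inner M U V + d\<^sup>2 * ?b\<^sup>2" for c d
  proof -
    have "L2_inner M (L2_scale M c U) (L2_scale M d V) = c * d * L2_inner M U V"
      using U V by (simp add: L2_inner_scale_left L2_inner_scale_right L2_scale_in_space)
    then show ?thesis
      using L2_inner_add_square[OF L2_scale_in_space[OF U, of c] L2_scale_in_space[OF V, of d]]
        L2_inner_self_nonneg[of M "L2_add M (L2_scale M c U) (L2_scale M d V)"] U V
      by (simp add: L2_norm_power2[symmetric] L2_norm_scale power_mult_distrib)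
  qed
  show ?thesis
  proof (cases "?a = 0 \<or> ?b = 0")
    case True
    have "L2_inner M (L2_zero M) W = 0" if "W \<in> L2_space M" for W
      using that by (auto elim!: L2_space_cases simp: L2_class_simps)
    then have "L2_inner M U V = 0"
      using True U V by (metis L2_norm_eq_0 L2_inner_commute)
    then show ?thesis
      by (simp add: L2_norm_nonneg)
  next
    case False
    then have pos: "0 < ?a * ?b"
      using L2_norm_nonneg[of M U] L2_norm_nonneg[of M V] by (simp add: less_le)
    have "0 \<le> 2 * (?a * ?b) * (?a * ?b - L2_inner M U V)"
      using sq[of ?b "- ?a"] by (simp add: algebra_simps power2_eq_square)
    then show ?thesis using pos by (simp add: zero_le_mult_iff)
  qed
qed

lemma L2_norm_triangle:
  assumes "U \<in> L2_space M" "V \<in> L2_space M"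
  shows "L2_norm M (L2_add M U V) \<le> L2_norm M U + L2_norm M V"
proof (rule power2_le_imp_le)
  show "(L2_norm M (L2_add M U V))\<^sup>2 \<le> (L2_norm M U + L2_norm M V)\<^sup>2"
    using L2_Cauchy_Schwarz[OF assms] L2_inner_add_square[OF assms]
    by (simp add: L2_norm_power2 power2_sum)
qed (simp add: L2_norm_nonneg)

subsection \<open>The norm topology\<close>

lemma L2_dist_eq_norm:
  assumes "U \<in> L2_space M" "V \<in> L2_space M"
  shows "L2_dist M U V = L2_norm M (L2_add M U (L2_scale M (-1) V))"
proof -
  obtain u v where u: "u \<in> L2_fun M" "U = L2_class M u" and v: "v \<in> L2_fun M" "V = L2_class M v"
    using assms by (auto elim!: L2_space_cases)
  define w where "w = (\<lambda>x. L2_rep U x + (-1) *\<^sub>R L2_rep V x)"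
  have U: "L2_rep U \<in> L2_fun M" "L2_class M (L2_rep U) = U"
    using L2_rep_class[OF u(1)] u by (simp_all add: L2_class_eq_iff)
  have V: "L2_rep V \<in> L2_fun M" "L2_class M (L2_rep V) = V"
    using L2_rep_class[OF v(1)] v by (simp_all add: L2_class_eq_iff)
  have w: "w \<in> L2_fun M"
    unfolding w_def by (intro L2_fun_add L2_fun_scale U V)
  have "L2_add M U (L2_scale M (-1) V) = L2_class M w"
    using L2_add_class[OF U(1) L2_fun_scale[OF V(1), of "-1"]] L2_scale_class[OF V(1), of "-1"]
    unfolding U(2) V(2) w_def by simp
  then have "L2_norm M (L2_add M U (L2_scale M (-1) V)) = sqrt (LINT x|M. w x \<bullet> w x)"
    using w by (simp add: L2_norm_def L2_inner_class)
  then show ?thesis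
    by (simp add: L2_dist_def w_def power2_norm_eq_inner)
qed

lemma L2_diff_split:
  assumes "U \<in> L2_space M" "V \<in> L2_space M" "W \<in> L2_space M"
  shows "L2_add M U (L2_scale M (-1) W)
    = L2_add M (L2_add M U (L2_scale M (-1) V)) (L2_add M V (L2_scale M (-1) W))"
proof -
  let ?m = "L2_scale M (-1)"
  have V: "?m V \<in> L2_space M" and W: "?m W \<in> L2_space M"
    using assms by (simp_all add: L2_scale_in_space)
  have "L2_add M (L2_add M U (?m V)) (L2_add M V (?m W))
    = L2_add M U (L2_add M (L2_add M (?m V) V) (?m W))"
    using assms V W by (simp add: L2_add_assoc L2_add_in_space)
  also have "\<dots> = L2_add M U (?m W)"
    using assms V W L2_add_commute[OF V assms(2)] L2_add_commute[OF L2_zero_in_space W]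
    by (simp add: L2_add_minus L2_add_zero)
  finally show ?thesis by simp
qed

lemma L2_diff_eq_zero:
  assumes "U \<in> L2_space M" "V \<in> L2_space M" "L2_add M U (L2_scale M (-1) V) = L2_zero M"
  shows "U = V"
proof -
  have "U = L2_add M U (L2_add M V (L2_scale M (-1) V))"
    using assms by (simp add: L2_add_minus L2_add_zero)
  also have "\<dots> = L2_add M V (L2_add M U (L2_scale M (-1) V))"
    using assms by (metis L2_add_assoc L2_add_commute L2_scale_in_space)
  also have "\<dots> = V"
    using assms by (simp add: L2_add_zero)
  finally show ?thesis .
qed

lemma L2_Metric_space: "Metric_space (L2_space M) (L2_dist M)"
proof
  fix U V W :: "('a \<Rightarrow> 'b) set"
  show "0 \<le> L2_dist M U V" "L2_dist M U V = L2_dist M V U"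
    by (simp_all add: L2_dist_def norm_minus_commute)
  assume UV: "U \<in> L2_space M" "V \<in> L2_space M"
  then show "L2_dist M U V = 0 \<longleftrightarrow> U = V"
    using L2_diff_eq_zero[OF UV] L2_add_minus
    by (auto simp: L2_dist_eq_norm L2_norm_eq_0 L2_add_in_space L2_scale_in_space)
  assume W: "W \<in> L2_space M"
  show "L2_dist M U W \<le> L2_dist M U V + L2_dist M V W"
    using UV W by (subst L2_dist_eq_norm, simp, simp, subst L2_diff_split[of U M V W])
      (simp_all add: L2_norm_triangle L2_dist_eq_norm L2_add_in_space L2_scale_in_space)
qed

lemma topspace_L2_topology: "topspace (L2_topology M) = L2_space M"
  by (simp add: L2_topology_def Metric_space.topspace_mtopology[OF L2_Metric_space])

lemma L2_dist_add_le:
  assumes "U \<in> L2_space M" "V \<in> L2_space M" "U' \<in> L2_space M" "V' \<in> L2_space M"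
  shows "L2_dist M (L2_add M U V) (L2_add M U' V') \<le> L2_dist M U U' + L2_dist M V V'"
proof -
  let ?m = "L2_scale M (-1)"
  have "L2_add M (L2_add M U V) (?m (L2_add M U' V'))
    = L2_add M (L2_add M U V) (L2_add M (?m U') (?m V'))"
    using assms by (simp add: L2_scale_add_right)
  also have "\<dots> = L2_add M (L2_add M U (?m U')) (L2_add M V (?m V'))"
  proof -
    have "L2_add M V (L2_add M (?m U') (?m V')) = L2_add M (?m U') (L2_add M V (?m V'))"
      using assms L2_add_commute[of V M "?m U'"]
      by (simp add: L2_scale_in_space flip: L2_add_assoc)
    then show ?thesis
      using assms by (simp add: L2_add_assoc L2_add_in_space L2_scale_in_space)
  qed
  finally show ?thesis
    using assms
    by (simp add: L2_dist_eq_norm L2_norm_triangle L2_add_in_space L2_scale_in_space)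
qed

lemma L2_dist_scale_le:
  assumes "U \<in> L2_space M" "V \<in> L2_space M"
  shows "L2_dist M (L2_scale M c U) (L2_scale M d V) \<le> \<bar>d\<bar> * L2_dist M U V + \<bar>c - d\<bar> * L2_norm M U"
proof -
  interpret Metric_space "L2_space M" "L2_dist M" by (rule L2_Metric_space)
  have "L2_add M (L2_scale M c U) (L2_scale M (-1) (L2_scale M d U)) = L2_scale M (c - d) U"
    using assms L2_scale_add_left[of U M c "- d"] by (simp add: L2_scale_scale)
  then have "L2_dist M (L2_scale M c U) (L2_scale M d U) = \<bar>c - d\<bar> * L2_norm M U"
    using assms by (simp add: L2_dist_eq_norm L2_scale_in_space L2_norm_scale)
  moreover
  have "L2_add M (L2_scale M d U) (L2_scale M (-1) (L2_scale M d V))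
    = L2_scale M d (L2_add M U (L2_scale M (-1) V))"
    using assms by (simp add: L2_scale_add_right L2_scale_in_space L2_scale_scale)
  then have "L2_dist M (L2_scale M d U) (L2_scale M d V) = \<bar>d\<bar> * L2_dist M U V"
    using assms by (simp add: L2_dist_eq_norm L2_scale_in_space L2_add_in_space L2_norm_scale)
  ultimately show ?thesis
    using triangle[of "L2_scale M c U" "L2_scale M d U" "L2_scale M d V"] assms
    by (simp add: L2_scale_in_space)
qed

theorem L2_topological_vector_space:
  "topological_vector_space (L2_topology M :: ('a \<Rightarrow> 'b::euclidean_space) set topology)
    (L2_add M) (L2_zero M) (L2_scale M)"
proof -
  interpret Metric_space "L2_space M :: ('a \<Rightarrow> 'b) set set" "L2_dist M" by (rule L2_Metric_space)
  have top: "L2_topology M = mtopology" by (simp add: L2_topology_def)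
  have "continuous_map (prod_topology mtopology mtopology) mtopology (\<lambda>(U, V). L2_add M U V)"
    unfolding continuous_map_to_metric case_prod_unfold
  proof (intro ballI allI impI)
    fix p :: "('a \<Rightarrow> 'b) set \<times> ('a \<Rightarrow> 'b) set" and e :: real
    assume p: "p \<in> topspace (prod_topology mtopology mtopology)" and e: "0 < e"
    obtain U V where UV: "p = (U, V)" "U \<in> L2_space M" "V \<in> L2_space M"
      using p by auto
    let ?N = "mball U (e/2) \<times> mball V (e/2)"
    have "L2_add M (fst q) (snd q) \<in> mball (L2_add M (fst p) (snd p)) e"
      if q: "q \<in> ?N" for q
    proof -
      obtain U' V' where q': "q = (U', V')" by (rule prod.exhaust)
      have "U' \<in> L2_space M" "V' \<in> L2_space M" "L2_dist M U U' < e/2" "L2_dist M V V' < e/2"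
        using q q' by auto
      then show ?thesis
        using L2_dist_add_le[of U M V U' V'] UV q' by (simp add: L2_add_in_space)
    qed
    moreover have "openin (prod_topology mtopology mtopology) ?N \<and> p \<in> ?N"
      using UV e by (simp_all add: openin_prod_Times_iff)
    ultimately show "\<exists>N. openin (prod_topology mtopology mtopology) N \<and> p \<in> N \<and>
        (\<forall>q\<in>N. L2_add M (fst q) (snd q) \<in> mball (L2_add M (fst p) (snd p)) e)"
      by (intro exI[of _ ?N]) simp
  qed
  moreover
  have "continuous_map (prod_topology euclideanreal mtopology) mtopology (\<lambda>(c, U). L2_scale M c U)"
    unfolding continuous_map_to_metric case_prod_unfold
  proof (intro ballI allI impI)
    fix p :: "real \<times> ('a \<Rightarrow> 'b) set" and e :: real
    assume p: "p \<in> topspace (prod_topology euclideanreal mtopology)" and e: "0 < e"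
    obtain c U where U: "p = (c, U)" "U \<in> L2_space M"
      using p by (cases p) simp
    define K where "K = \<bar>c\<bar> + 1 + L2_norm M U"
    define r where "r = min 1 (e / K)"
    have K: "0 < K" using L2_norm_nonneg[of M U] by (simp add: K_def)
    have r: "0 < r" "r \<le> 1" "r * K \<le> e" using e K by (simp_all add: r_def min_def field_simps)
    let ?N = "ball c r \<times> mball U r"
    have "L2_scale M (fst q) (snd q) \<in> mball (L2_scale M (fst p) (snd p)) e"
      if q: "q \<in> ?N" for q
    proof -
      obtain d V where q': "q = (d, V)" by (rule prod.exhaust)
      have V: "V \<in> L2_space M" "L2_dist M U V < r" "\<bar>c - d\<bar> < r"
        using q q' by (simp_all add: dist_real_def)
      have d: "\<bar>d\<bar> < \<bar>c\<bar> + 1" using V r by linarith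
      have "\<bar>d\<bar> * L2_dist M U V \<le> (\<bar>c\<bar> + 1) * L2_dist M U V"
        using d by (intro mult_right_mono) auto
      also have "\<dots> < (\<bar>c\<bar> + 1) * r"
        using V by (intro mult_strict_left_mono) auto
      finally have 1: "\<bar>d\<bar> * L2_dist M U V < (\<bar>c\<bar> + 1) * r" .
      have 2: "\<bar>c - d\<bar> * L2_norm M U \<le> r * L2_norm M U"
        using V L2_norm_nonneg[of M U] by (intro mult_right_mono) auto
      have "L2_dist M (L2_scale M c U) (L2_scale M d V) < r * K"
        using L2_dist_scale_le[OF U(2) V(1), of c d] 1 2 by (simp add: K_def algebra_simps)
      then show ?thesis
        using U V q' r by (simp add: L2_scale_in_space)
    qed
    moreover have "openin (prod_topology euclideanreal mtopology) ?N \<and> p \<in> ?N"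
      using U r by (simp_all add: openin_prod_Times_iff)
    ultimately show "\<exists>N. openin (prod_topology euclideanreal mtopology) N \<and> p \<in> N \<and>
        (\<forall>q\<in>N. L2_scale M (fst q) (snd q) \<in> mball (L2_scale M (fst p) (snd p)) e)"
      by (intro exI[of _ ?N]) simp
  qed
  ultimately show ?thesis
    unfolding top
    by unfold_locales
      (simp_all add: L2_add_assoc L2_add_zero L2_zero_in_space L2_add_minus L2_scale_one
        L2_scale_scale L2_scale_add_left L2_scale_add_right, rule L2_add_commute)
qed

section \<open>The integral operator\<close>

definition volterra ::
  "real \<Rightarrow> real \<Rightarrow> (real \<Rightarrow> real \<Rightarrow> 'b::euclidean_space \<Rightarrow> 'b) \<Rightarrow> (real \<Rightarrow> 'b) set \<Rightarrow> (real \<Rightarrow> 'b) set"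
  where "volterra t0 T \<phi> U =
    L2_class (lebesgue_on {t0..T}) (\<lambda>t. LINT s|lebesgue_on {t0..t}. \<phi> t s (L2_rep U s))"

lemma lebesgue_on_integral_cong_AE:
  fixes f g :: "'a::euclidean_space \<Rightarrow> 'b::euclidean_space"
  assumes S: "S \<in> sets lebesgue" and ae: "AE x in lebesgue_on S. f x = g x"
  shows "(LINT x|lebesgue_on S. f x) = (LINT x|lebesgue_on S. g x)"
proof -
  let ?f = "\<lambda>x. indicator S x *\<^sub>R f x" and ?g = "\<lambda>x. indicator S x *\<^sub>R g x"
  have ae': "AE x in lebesgue. ?f x = ?g x"
    using ae S by (auto simp: AE_restrict_space_iff indicator_def elim!: eventually_mono)
  then have ae'': "AE x in lebesgue. ?g x = ?f x"
    by (auto elim!: eventually_mono)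
  have "integral\<^sup>L lebesgue ?f = integral\<^sup>L lebesgue ?g"
  proof (cases "?f \<in> borel_measurable lebesgue")
    case True
    then show ?thesis
      using borel_measurable_AE[OF True ae'] ae' by (intro integral_cong_AE)
  next
    case False
    then have "?g \<notin> borel_measurable lebesgue"
      using borel_measurable_AE[OF _ ae''] by blast
    then show ?thesis
      using False by (metis borel_measurable_integrable not_integrable_integral_eq)
  qed
  then show ?thesis
    using S by (simp add: integral_restrict_space)
qed

text \<open>The operator does not depend on the representative.\<close>

lemma volterra_class:
  assumes u: "u \<in> L2_fun (lebesgue_on {t0..T})"
  shows "volterra t0 T \<phi> (L2_class (lebesgue_on {t0..T}) u) =
    L2_class (lebesgue_on {t0..T}) (\<lambda>t. LINT s|lebesgue_on {t0..t}. \<phi> t s (u s))"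
proof -
  let ?M = "lebesgue_on {t0..T}"
  let ?r = "L2_rep (L2_class ?M u)"
  have "(LINT s|lebesgue_on {t0..t}. \<phi> t s (?r s)) = (LINT s|lebesgue_on {t0..t}. \<phi> t s (u s))"
    if "t \<in> {t0..T}" for t
  proof (rule lebesgue_on_integral_cong_AE)
    have "AE s in lebesgue. s \<in> {t0..T} \<longrightarrow> ?r s = u s"
      using L2_rep_class(2)[OF u] by (simp add: AE_restrict_space_iff)
    then have "AE s in lebesgue. s \<in> {t0..t} \<longrightarrow> \<phi> t s (?r s) = \<phi> t s (u s)"
      using that by (auto elim!: eventually_mono)
    then show "AE s in lebesgue_on {t0..t}. \<phi> t s (?r s) = \<phi> t s (u s)"
      by (simp add: AE_restrict_space_iff)
  qed simp
  then have eq: "(LINT s|lebesgue_on {t0..t}. \<phi> t s (?r s)) =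
      (LINT s|lebesgue_on {t0..t}. \<phi> t s (u s))" if "t \<in> space ?M" for t
    using that by simp
  have "w \<in> L2_class ?M f \<longleftrightarrow> w \<in> L2_class ?M g" 
    if fg: "\<And>t. t \<in> space ?M \<Longrightarrow> f t = g t" for w f g :: "real \<Rightarrow> 'a"
  proof -
    have "f \<in> borel_measurable ?M \<longleftrightarrow> g \<in> borel_measurable ?M"
      using fg by (rule measurable_cong)
    moreover have "integrable ?M (\<lambda>x. (norm (f x))\<^sup>2) \<longleftrightarrow> integrable ?M (\<lambda>x. (norm (g x))\<^sup>2)"
      using fg by (intro Bochner_Integration.integrable_cong) auto
    moreover have "(AE t in ?M. f t = w t) \<longleftrightarrow> (AE t in ?M. g t = w t)"
      using fg by (intro AE_cong) auto
    ultimately show ?thesis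
      by (simp add: L2_in_class_iff L2_fun_def)
  qed
  from this[OF eq] show ?thesis
    unfolding volterra_def by (intro set_eqI)
qed

end

theory Submission
  imports Defs
begin

text \<open>
  The values of the Volterra operator are continuous functions, so in \<open>h = g + f(h)\<close> the unknown
  may be taken to be the continuous function \<open>z = f(h)\<close>, which solves \<open>z = f(g + z)\<close>.  In the
  Bielecki norm \<open>sup |z(t)| exp(-2L(t - t0))\<close>, where \<open>L\<close> is a Lipschitz constant, the map
  \<open>z \<mapsto> f(g + z)\<close> is a contraction with factor \<open>1/2\<close>; Banach's theorem thus replaces completeness
  of \<open>L\<^sup>2\<close> by that of the continuous functions.  The same estimate shows that the solution depends
  Lipschitz-continuously on \<open>g\<close>, first in \<open>L\<^sup>1\<close> and then in \<open>L\<^sup>2\<close>.  Hence there is a continuous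
  solution map \<open>S\<close>, and \<open>S \<circ> g\<close> is the only solution for a continuous family \<open>g\<close>.
\<close>

section \<open>Square-integrable functions\<close>

text \<open>The bound \<open>2 * norm (u x) \<le> 1 + (norm (u x))\<^sup>2\<close> suffices,
  constants being integrable over a finite measure. The estimates for the integral operator can
  therefore be made in L1.\<close>

lemma L2_fun_imp_integrable:
  fixes u :: "'a \<Rightarrow> 'b::euclidean_space"
  assumes "finite_measure M" "u \<in> L2_fun M"
  shows "integrable M u"
proof -
  interpret finite_measure M by fact
  have "integrable M (\<lambda>x. 1 + (norm (u x))\<^sup>2)"
    using assms(2) by (simp add: L2_fun_def)
  moreover have "u \<in> borel_measurable M"
    using assms(2) by (simp add: L2_fun_def)
  moreover have "norm (u x) \<le> norm (1 + (norm (u x))\<^sup>2)" for x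
  proof -
    have "norm (u x) \<le> 2 * 1 * norm (u x)" by simp
    also have "\<dots> \<le> 1\<^sup>2 + (norm (u x))\<^sup>2" by (rule sum_squares_bound)
    finally show ?thesis by simp
  qed
  ultimately show ?thesis
    by (rule Bochner_Integration.integrable_bound[OF _ _ AE_I2])
qed

lemma bounded_in_L2_fun:
  fixes f :: "'a \<Rightarrow> 'b::euclidean_space"
  assumes "finite_measure M" "f \<in> borel_measurable M" "\<And>x. x \<in> space M \<Longrightarrow> norm (f x) \<le> B"
  shows "f \<in> L2_fun M"
proof -
  interpret finite_measure M by fact
  have "norm ((norm (f x))\<^sup>2) \<le> B\<^sup>2" if "x \<in> space M" for x
    using power_mono[OF assms(3)[OF that], of 2] by simp
  then have "integrable M (\<lambda>x. (norm (f x))\<^sup>2)"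
    using assms(2) by (intro integrable_const_bound[where B = "B\<^sup>2"] AE_I2) auto
  with assms(2) show ?thesis by (simp add: L2_fun_def)
qed

lemma continuous_in_L2_fun:
  fixes f :: "real \<Rightarrow> 'b::euclidean_space"
  assumes "continuous_on {a..b} f"
  shows "f \<in> L2_fun (lebesgue_on {a..b})"
proof -
  have "bounded (f ` {a..b})"
    by (intro compact_imp_bounded compact_continuous_image assms) simp
  then obtain B where "\<And>x. x \<in> {a..b} \<Longrightarrow> norm (f x) \<le> B"
    unfolding bounded_iff by blast
  then show ?thesis
    using assms by (intro bounded_in_L2_fun continuous_imp_measurable_on_sets_lebesgue
      finite_measure_lebesgue_on) auto
qed

section \<open>The L2 distance compared with L1 and sup bounds\<close>

lemma L2_dist_class:
  assumes "u \<in> L2_fun M" "v \<in> L2_fun M"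
  shows "L2_dist M (L2_class M u) (L2_class M v) = sqrt (LINT x|M. (norm (u x - v x))\<^sup>2)"
proof -
  have [measurable]: "u \<in> borel_measurable M" "v \<in> borel_measurable M"
    "L2_rep (L2_class M u) \<in> borel_measurable M" "L2_rep (L2_class M v) \<in> borel_measurable M"
    using assms L2_rep_class(1) by (auto simp: L2_fun_def)
  have "AE x in M. (norm (L2_rep (L2_class M u) x - L2_rep (L2_class M v) x))\<^sup>2
      = (norm (u x - v x))\<^sup>2"
    using L2_rep_class(2)[OF assms(1)] L2_rep_class(2)[OF assms(2)] by eventually_elim simp
  then show ?thesis
    unfolding L2_dist_def by (intro arg_cong[where f = sqrt] integral_cong_AE) measurable
qed

text \<open>Cauchy-Schwarz for the scalar functions \<open>norm (w x)\<close> and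
  \<open>1\<close>.\<close>

lemma integral_norm_le_L2_norm:
  fixes w :: "'a \<Rightarrow> 'b::euclidean_space"
  assumes "finite_measure M" "w \<in> L2_fun M"
  shows "(LINT x|M. norm (w x)) \<le> sqrt (measure M (space M)) * sqrt (LINT x|M. (norm (w x))\<^sup>2)"
proof -
  interpret finite_measure M by fact
  define n where "n = (\<lambda>x. norm (w x))"
  have n: "n \<in> L2_fun M"
    using assms(2) by (auto simp: L2_fun_def n_def)
  have one: "(\<lambda>_. 1 :: real) \<in> L2_fun M"
    by (simp add: L2_fun_def)
  show ?thesis
    using L2_Cauchy_Schwarz[OF L2_class_in_space[OF one] L2_class_in_space[OF n]] n one
    by (simp add: L2_inner_class L2_norm_def n_def power2_eq_square)
qed

lemma integral_norm_diff_le_L2_dist: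
  fixes u v :: "'a \<Rightarrow> 'b::euclidean_space"
  assumes "finite_measure M" "u \<in> L2_fun M" "v \<in> L2_fun M"
  shows "(LINT x|M. norm (u x - v x))
    \<le> sqrt (measure M (space M)) * L2_dist M (L2_class M u) (L2_class M v)"
  using integral_norm_le_L2_norm[OF assms(1) L2_fun_add[OF assms(2) L2_fun_scale[OF assms(3), of "-1"]]]
  by (simp add: L2_dist_class[OF assms(2,3)])

text \<open>The way back from the sup norm to L2: the integral operator takes L1 bounds to pointwise
  bounds, which this turns into L2 bounds.\<close>

lemma L2_dist_class_le:
  fixes u v :: "'a \<Rightarrow> 'b::euclidean_space"
  assumes "finite_measure M" "u \<in> L2_fun M" "v \<in> L2_fun M"
    and bound: "\<And>x. x \<in> space M \<Longrightarrow> norm (u x - v x) \<le> B"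
    and "0 \<le> B"
  shows "L2_dist M (L2_class M u) (L2_class M v) \<le> sqrt (measure M (space M)) * B"
proof -
  interpret finite_measure M by fact
  have "(\<lambda>x. u x + (-1) *\<^sub>R v x) \<in> L2_fun M"
    by (intro L2_fun_add L2_fun_scale assms)
  then have "integrable M (\<lambda>x. (norm (u x - v x))\<^sup>2)"
    by (simp add: L2_fun_def)
  moreover have "(norm (u x - v x))\<^sup>2 \<le> B\<^sup>2" if "x \<in> space M" for x
    using bound[OF that] by (rule power_mono) simp
  ultimately have "(LINT x|M. (norm (u x - v x))\<^sup>2) \<le> (LINT x|M. B\<^sup>2)"
    by (intro integral_mono) auto
  then have "sqrt (LINT x|M. (norm (u x - v x))\<^sup>2) \<le> sqrt (measure M (space M) * B\<^sup>2)"
    by simp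
  then show ?thesis
    using \<open>0 \<le> B\<close> by (simp add: L2_dist_class[OF assms(2,3)] real_sqrt_mult)
qed

section \<open>Lipschitz maps and machines\<close>

lemma continuous_map_L2_Lipschitz:
  assumes "\<And>U. U \<in> L2_space M \<Longrightarrow> F U \<in> L2_space N"
    and "\<And>U V. U \<in> L2_space M \<Longrightarrow> V \<in> L2_space M \<Longrightarrow> L2_dist N (F U) (F V) \<le> C * L2_dist M U V"
  shows "continuous_map (L2_topology M) (L2_topology N) F"
proof -
  interpret Metric_space "L2_space M" "L2_dist M" by (rule L2_Metric_space)
  \<comment> \<open>\<open>C\<close> may fail to be positive; the enlarged constant allows
    \<open>\<delta> = \<epsilon> / D\<close>.\<close>
  define D where "D = max C 1"
  have D: "D > 0" by (simp add: D_def)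
  have le: "L2_dist N (F U) (F V) \<le> D * L2_dist M U V"
    if "U \<in> L2_space M" "V \<in> L2_space M" for U V
    by (rule order_trans[OF assms(2)[OF that]], rule mult_right_mono) (auto simp: D_def)
  have "\<exists>\<delta>>0. \<forall>V. V \<in> L2_space M \<and> L2_dist M U V < \<delta> \<longrightarrow> L2_dist N (F U) (F V) < \<epsilon>"
    if U: "U \<in> L2_space M" and e: "\<epsilon> > 0" for U \<epsilon>
  proof (intro exI[of _ "\<epsilon> / D"] conjI allI impI)
    fix V assume V: "V \<in> L2_space M \<and> L2_dist M U V < \<epsilon> / D"
    then have "D * L2_dist M U V < \<epsilon>"
      using D by (simp add: field_simps)
    then show "L2_dist N (F U) (F V) < \<epsilon>"
      using le[OF U] V by force
  qed (use D e in simp)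
  then show ?thesis
    unfolding L2_topology_def metric_continuous_map[OF L2_Metric_space] using assms(1) by blast
qed

text \<open>Stability is used twice. For \<open>G = G'\<close> it puts two solutions at distance 0,
  so solutions are unique; for distinct \<open>G\<close> and \<open>G'\<close> it makes the solution
  map \<open>S\<close> Lipschitz, so that \<open>S \<circ> g\<close> is a continuous solution. Any
  other solution agrees with it at each point of the test space.\<close>

lemma L2_machineI:
  fixes F :: "('a \<Rightarrow> 'b::euclidean_space) set \<Rightarrow> ('a \<Rightarrow> 'b) set"
  assumes F: "continuous_map (L2_topology M) (L2_topology M) F"
    and ex: "\<And>G. G \<in> L2_space M \<Longrightarrow> \<exists>H \<in> L2_space M. H = L2_add M G (F H)"
    and stable: "\<And>G G' H H'. \<lbrakk>G \<in> L2_space M; G' \<in> L2_space M; H \<in> L2_space M; H' \<in> L2_space M;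
        H = L2_add M G (F H); H' = L2_add M G' (F H')\<rbrakk> \<Longrightarrow> L2_dist M H H' \<le> C * L2_dist M G G'"
  shows "topological_vector_space.machine (L2_topology M) (L2_add M) TYPE('x) F"
  unfolding topological_vector_space.machine_def[OF L2_topological_vector_space]
proof (intro conjI F allI impI)
  interpret Metric_space "L2_space M :: ('a \<Rightarrow> 'b) set set" "L2_dist M" by (rule L2_Metric_space)
  fix X :: "'x topology" and g :: "'x \<Rightarrow> ('a \<Rightarrow> 'b) set"
  assume g: "continuous_map X (L2_topology M) g"
  have unique: "H = H'" if "G \<in> L2_space M" "H \<in> L2_space M" "H' \<in> L2_space M"
    "H = L2_add M G (F H)" "H' = L2_add M G (F H')" for G H H'
  proof -
    have "L2_dist M H H' \<le> C * L2_dist M G G"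
      using that by (intro stable)
    then have "L2_dist M H H' = 0"
      using mdist_zero[OF that(1)] nonneg[of H H'] by simp
    then show ?thesis using zero that by blast
  qed
  from ex obtain S where S: "\<And>G. G \<in> L2_space M \<Longrightarrow> S G \<in> L2_space M"
    "\<And>G. G \<in> L2_space M \<Longrightarrow> S G = L2_add M G (F (S G))"
    by metis
  have "continuous_map (L2_topology M) (L2_topology M) S"
  proof (rule continuous_map_L2_Lipschitz[where C = C, OF S(1)])
    fix G G' :: "('a \<Rightarrow> 'b) set"
    assume "G \<in> L2_space M" "G' \<in> L2_space M"
    then show "L2_dist M (S G) (S G') \<le> C * L2_dist M G G'"
      by (intro stable S)
  qed
  then have cont: "continuous_map X (L2_topology M) (S \<circ> g)"
    using g continuous_map_compose by blast
  have gX: "g x \<in> L2_space M" if "x \<in> topspace X" for x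
    using g that by (auto simp: continuous_map_def topspace_L2_topology)
  let ?P = "\<lambda>h. h \<in> extensional (topspace X) \<and> continuous_map X (L2_topology M) h \<and>
    (\<forall>x\<in>topspace X. h x = L2_add M (g x) (F (h x)))"
  show "\<exists>!h. ?P h"
  proof (rule ex1I[of ?P "restrict (S \<circ> g) (topspace X)"])
    show "?P (restrict (S \<circ> g) (topspace X))"
    proof (intro conjI ballI)
      show "continuous_map X (L2_topology M) (restrict (S \<circ> g) (topspace X))"
        using cont by (rule continuous_map_eq) simp
      show "restrict (S \<circ> g) (topspace X) x = L2_add M (g x) (F (restrict (S \<circ> g) (topspace X) x))"
        if "x \<in> topspace X" for x
        using S(2)[OF gX[OF that]] that by simp
    qed simp
    fix h assume h: "?P h"
    have "h x = S (g x)" if x: "x \<in> topspace X" for x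
    proof (rule unique[OF gX[OF x] _ S(1)[OF gX[OF x]] _ S(2)[OF gX[OF x]]])
      show "h x \<in> L2_space M"
        using h x by (auto simp: continuous_map_def topspace_L2_topology)
      show "h x = L2_add M (g x) (F (h x))"
        using h x by blast
    qed
    then show "h = restrict (S \<circ> g) (topspace X)"
      using h by (intro extensionalityI[of h "topspace X"]) auto
  qed
qed

section \<open>Volterra operators with Lipschitz kernels\<close>

text \<open>The antiderivative \<open>exp (k * (s - a)) / k\<close>, with its value
  \<open>1 / k\<close> at the left endpoint discarded.\<close>

lemma lebesgue_on_integral_exp_le:
  fixes a t k :: real
  assumes "a \<le> t" "k > 0"
  shows "(LINT s|lebesgue_on {a..t}. exp (k * (s - a))) \<le> exp (k * (t - a)) / k"
proof -
  have "((\<lambda>s. exp (k * (s - a))) has_integral exp (k * (t - a)) / k - exp (k * (a - a)) / k) {a..t}"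
    using assms by (intro fundamental_theorem_of_calculus)
      (auto intro!: derivative_eq_intros simp flip: has_real_derivative_iff_has_vector_derivative)
  moreover have "integrable (lebesgue_on {a..t}) (\<lambda>s. exp (k * (s - a)))"
    by (intro continuous_imp_integrable_real continuous_intros)
  ultimately show ?thesis
    using assms by (simp add: lebesgue_integral_eq_integral integral_unique)
qed

lemma lebesgue_on_integral_mono_interval:
  fixes f :: "real \<Rightarrow> real"
  assumes "integrable (lebesgue_on {a..b}) f" "\<And>x. x \<in> {a..b} \<Longrightarrow> 0 \<le> f x" "t \<le> b"
  shows "(LINT s|lebesgue_on {a..t}. f s) \<le> (LINT s|lebesgue_on {a..b}. f s)"
proof -
  have i: "integrable (lebesgue_on {a..t}) f"
    by (rule integrable_subinterval[OF assms(1)]) (use assms(3) in auto)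
  show ?thesis
    using assms i by (simp add: lebesgue_integral_eq_integral)
      (intro integral_subset_le, auto intro!: integrable_on_lebesgue_on)
qed

text \<open>The Lipschitz constant is taken positive because the weighted estimates divide by
  \<open>2 * L\<close>; a given constant can always be enlarged.\<close>

locale volterra_kernel =
  fixes t0 T L :: real and \<phi> :: "real \<Rightarrow> real \<Rightarrow> 'b::euclidean_space \<Rightarrow> 'b"
  assumes interval: "t0 \<le> T"
    and cont: "continuous_on {(t, s, v). t0 \<le> s \<and> s \<le> t \<and> t \<le> T} (\<lambda>(t, s, v). \<phi> t s v)"
    and L_pos: "L > 0"
    and lipschitz: "\<lbrakk>t0 \<le> s; s \<le> t; t \<le> T\<rbrakk> \<Longrightarrow> norm (\<phi> t s v - \<phi> t s w) \<le> L * norm (v - w)"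
begin

abbreviation J :: "real measure" where "J \<equiv> lebesgue_on {t0..T}"

text \<open>The integral operator on functions instead of classes, so that its values at single
  points make sense.\<close>

definition V :: "(real \<Rightarrow> 'b) \<Rightarrow> real \<Rightarrow> 'b" where
  "V u t = (LINT s|lebesgue_on {t0..t}. \<phi> t s (u s))"

lemma finite_J: "finite_measure J"
  by (simp add: finite_measure_lebesgue_on)

section \<open>Growth, measurability and integrability of the kernel along a function\<close>

lemma continuous_kernel:
  assumes "continuous_on A p" "continuous_on A q" "continuous_on A r"
    and "\<And>x. x \<in> A \<Longrightarrow> t0 \<le> q x \<and> q x \<le> p x \<and> p x \<le> T"
  shows "continuous_on A (\<lambda>x. \<phi> (p x) (q x) (r x))"
proof -
  have "continuous_on A (\<lambda>x. (p x, q x, r x))"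
    using assms by (intro continuous_intros)
  from continuous_on_compose2[OF cont this] show ?thesis using assms(4) by auto
qed

text \<open>On the compact triangle \<open>t0 \<le> s \<le> t \<le> T\<close> the continuous
  function \<open>\<phi> t s 0\<close> is bounded, and the Lipschitz condition controls the distance
  from it. Affine growth in \<open>v\<close> keeps the integrand integrable along any integrable
  \<open>u\<close>.\<close>

lemma kernel_growth:
  obtains K where "\<And>t s v. \<lbrakk>t0 \<le> s; s \<le> t; t \<le> T\<rbrakk> \<Longrightarrow> norm (\<phi> t s v) \<le> K + L * norm v"
proof -
  let ?D = "{t0..T} \<times> {t0..T} \<inter> {p. snd p \<le> fst p}"
  have "closed {p :: real \<times> real. snd p \<le> fst p}"
    by (intro closed_Collect_le continuous_intros)
  then have "compact ?D"
    by (intro compact_Int_closed compact_Times) auto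
  moreover have "continuous_on ?D (\<lambda>p. \<phi> (fst p) (snd p) 0)"
    by (intro continuous_kernel continuous_intros) auto
  ultimately have "bounded ((\<lambda>p. \<phi> (fst p) (snd p) 0) ` ?D)"
    by (intro compact_imp_bounded compact_continuous_image)
  then obtain K where K: "\<And>p. p \<in> ?D \<Longrightarrow> norm (\<phi> (fst p) (snd p) 0) \<le> K"
    unfolding bounded_iff by blast
  have "norm (\<phi> t s v) \<le> K + L * norm v" if "t0 \<le> s" "s \<le> t" "t \<le> T" for t s v
    using K[of "(t, s)"] lipschitz[OF that, of v 0] norm_triangle_sub[of "\<phi> t s v" "\<phi> t s 0"] that
    by simp
  then show ?thesis by (rule that)
qed

text \<open>The measurable map \<open>s \<mapsto> (s, u s)\<close> into a Borel space is followed by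
  a map that is continuous, hence Borel, on the strip \<open>{t0..t} \<times> UNIV\<close>.\<close>

lemma kernel_measurable:
  assumes "u \<in> borel_measurable J" "t \<le> T"
  shows "(\<lambda>s. \<phi> t s (u s)) \<in> borel_measurable (lebesgue_on {t0..t})"
proof -
  have [measurable]: "u \<in> borel_measurable (lebesgue_on {t0..t})"
    using assms by (auto intro: measurable_restrict_mono)
  have [measurable]: "(\<lambda>s. s) \<in> borel_measurable (lebesgue_on {t0..t})"
    by (intro continuous_imp_measurable_on_sets_lebesgue continuous_intros) auto
  have pair: "(\<lambda>s. (s, u s)) \<in> lebesgue_on {t0..t} \<rightarrow>\<^sub>M restrict_space borel ({t0..t} \<times> UNIV)"
    by (rule measurable_restrict_space2) auto
  have "(\<lambda>p. \<phi> t (fst p) (snd p)) \<in> borel_measurable (restrict_space borel ({t0..t} \<times> UNIV))"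
    using assms(2) by (intro borel_measurable_continuous_on_restrict continuous_kernel continuous_intros) auto
  from measurable_compose[OF pair this] show ?thesis
    by simp
qed

lemma kernel_integrable:
  assumes "integrable J u" "t \<le> T"
  shows "integrable (lebesgue_on {t0..t}) (\<lambda>s. \<phi> t s (u s))"
proof -
  obtain K where K: "\<And>t s v. \<lbrakk>t0 \<le> s; s \<le> t; t \<le> T\<rbrakk> \<Longrightarrow> norm (\<phi> t s v) \<le> K + L * norm v"
    by (rule kernel_growth) blast
  interpret finite_measure "lebesgue_on {t0..t}"
    by (simp add: finite_measure_lebesgue_on)
  have "integrable (lebesgue_on {t0..t}) u"
    by (rule integrable_subinterval[OF assms(1)]) (use assms(2) in auto)
  then have "integrable (lebesgue_on {t0..t}) (\<lambda>s. K + L * norm (u s))"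
    by simp
  moreover have "(\<lambda>s. \<phi> t s (u s)) \<in> borel_measurable (lebesgue_on {t0..t})"
    using assms by (intro kernel_measurable) auto
  moreover have "norm (\<phi> t s (u s)) \<le> norm (K + L * norm (u s))" if "s \<in> {t0..t}" for s
    using K[of s t "u s"] that assms(2) by simp
  ultimately show ?thesis
    by (rule Bochner_Integration.integrable_bound[OF _ _ AE_I2]) simp
qed

section \<open>Values of the integral operator: Lipschitz bound and continuity\<close>

lemma V_lipschitz:
  assumes u: "integrable J u" and v: "integrable J v" and t: "t \<le> T"
  shows "norm (V u t - V v t) \<le> L * (LINT s|lebesgue_on {t0..t}. norm (u s - v s))"
proof -
  have i: "integrable (lebesgue_on {t0..t}) (\<lambda>s. u s - v s)"
    by (rule integrable_subinterval[OF Bochner_Integration.integrable_diff[OF u v]]) (use t in auto)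
  have "V u t - V v t = (LINT s|lebesgue_on {t0..t}. \<phi> t s (u s) - \<phi> t s (v s))"
    unfolding V_def using kernel_integrable u v t by simp
  also have "norm \<dots> \<le> (LINT s|lebesgue_on {t0..t}. norm (\<phi> t s (u s) - \<phi> t s (v s)))"
    by (rule integral_norm_bound)
  also have "\<dots> \<le> (LINT s|lebesgue_on {t0..t}. L * norm (u s - v s))"
    using i kernel_integrable u v t lipschitz by (intro integral_mono) auto
  finally show ?thesis by simp
qed

text \<open>Equations between classes hold only almost everywhere; after applying \<open>V\<close>
  they hold at every point of the interval.\<close>

lemma V_cong_AE:
  assumes "AE s in J. u s = v s" "t \<le> T"
  shows "V u t = V v t"
proof -
  have "AE s in lebesgue. s \<in> {t0..T} \<longrightarrow> u s = v s"
    using assms(1) by (simp add: AE_restrict_space_iff)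
  then have "AE s in lebesgue_on {t0..t}. \<phi> t s (u s) = \<phi> t s (v s)"
    using assms(2) by (auto simp: AE_restrict_space_iff elim!: eventually_mono)
  then show ?thesis
    unfolding V_def by (intro lebesgue_on_integral_cong_AE) auto
qed

text \<open>Dominated convergence along sequences \<open>x n\<close> tending to \<open>t\<close>.
  The moving upper limit becomes an indicator, so that all integrals run over one fixed space with
  the common bound \<open>K + L * norm (u s)\<close>.\<close>

lemma continuous_V:
  assumes u: "integrable J u"
  shows "continuous_on {t0..T} (V u)"
  unfolding continuous_on_sequentially
proof (intro allI ballI impI)
  fix x and t
  assume t: "t \<in> {t0..T}" and "(\<forall>n. x n \<in> {t0..T}) \<and> x \<longlonglongrightarrow> t"
  then have x: "\<And>n. x n \<in> {t0..T}" and lim: "x \<longlonglongrightarrow> t" by auto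
  obtain K where K: "\<And>t s v. \<lbrakk>t0 \<le> s; s \<le> t; t \<le> T\<rbrakk> \<Longrightarrow> norm (\<phi> t s v) \<le> K + L * norm v"
    by (rule kernel_growth) blast
  let ?f = "\<lambda>r s. indicator {t0..r} s *\<^sub>R \<phi> r s (u s)"
  have V: "V u r = (LINT s|lebesgue. ?f r s)" for r
    unfolding V_def by (subst integral_restrict_space) auto
  have meas: "?f r \<in> borel_measurable lebesgue" if "r \<in> {t0..T}" for r
  proof -
    have "(\<lambda>s. \<phi> r s (u s)) \<in> borel_measurable (lebesgue_on {t0..r})"
      using u that by (intro kernel_measurable) auto
    then show ?thesis
      by (simp add: borel_measurable_restrict_space_iff)
  qed
  \<comment> \<open>Where the indicator of \<open>{t0..x n}\<close> vanishes, domination amounts to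
    nonnegativity of the bound.\<close>
  have pos: "0 \<le> K + L * norm (u s)" if "s \<in> {t0..T}" for s
    by (rule order_trans[OF norm_ge_zero K[of s s]]) (use that in auto)
  interpret finite_measure J by (rule finite_J)
  have "(\<lambda>n. LINT s|lebesgue. ?f (x n) s) \<longlonglongrightarrow> (LINT s|lebesgue. ?f t s)"
  proof (rule integral_dominated_convergence)
    have "integrable J (\<lambda>s. K + L * norm (u s))" using u by simp
    then show "integrable lebesgue (\<lambda>s. indicator {t0..T} s *\<^sub>R (K + L * norm (u s)))"
      by (subst (asm) integrable_restrict_space) auto
    show "AE s in lebesgue. norm (?f (x n) s) \<le> indicator {t0..T} s *\<^sub>R (K + L * norm (u s))" for n
      using x[of n] K pos by (intro AE_I2) (auto simp: indicator_def)
    \<comment> \<open>At \<open>s = t\<close> the indicators may oscillate, since \<open>x n\<close>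
      can lie on both sides of \<open>t\<close>.\<close>
    have "AE s in lebesgue. s \<noteq> t"
      by (rule AE_completion) (rule AE_lborel_singleton)
    then show "AE s in lebesgue. (\<lambda>n. ?f (x n) s) \<longlonglongrightarrow> ?f t s"
    proof eventually_elim
      case (elim s)
      show ?case
      proof (cases "t0 \<le> s \<and> s < t")
        case True
        then have ev: "eventually (\<lambda>n. s < x n) sequentially"
          using lim by (auto intro: order_tendstoD)
        have "continuous_on {s..T} (\<lambda>r. \<phi> r s (u s))"
          using True by (intro continuous_kernel continuous_intros) auto
        moreover have "eventually (\<lambda>n. x n \<in> {s..T}) sequentially"
          using ev by eventually_elim (use x in auto)
        ultimately have "(\<lambda>n. \<phi> (x n) s (u s)) \<longlonglongrightarrow> \<phi> t s (u s)"
          using lim t True by (auto intro: continuous_on_tendsto_compose)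
        moreover have "eventually (\<lambda>n. ?f (x n) s = \<phi> (x n) s (u s)) sequentially"
          using ev by eventually_elim (use True in auto)
        ultimately show ?thesis
          using True by (simp add: tendsto_cong)
      next
        case False
        have "eventually (\<lambda>n. ?f (x n) s = 0) sequentially"
        proof (cases "t0 \<le> s")
          case True
          with False elim have "t < s" by simp
          then have "eventually (\<lambda>n. x n < s) sequentially"
            using lim by (auto intro: order_tendstoD)
          then show ?thesis by eventually_elim auto
        qed simp
        moreover have "?f t s = 0"
          using False elim by (auto simp: indicator_def)
        ultimately show ?thesis
          by (simp only: tendsto_eventually)
      qed
    qed
  qed (use meas t x in auto)
  then show "(V u \<circ> x) \<longlonglongrightarrow> V u t"
    by (simp add: V o_def)
qed


section \<open>Weighted estimate and the equation among continuous functions\<close>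

abbreviation weight :: "real \<Rightarrow> real" where
  "weight t \<equiv> exp (2 * L * (t - t0))"

text \<open>The integral in \<open>V_lipschitz\<close> stops at \<open>t\<close>, and
  \<open>L\<close> times the integral of \<open>weight\<close> up to \<open>t\<close> is at most
  \<open>weight t / 2\<close>. The choice \<open>w = 0\<close> gives the contraction,
  \<open>w = norm (g - g')\<close> the stability of solutions.\<close>

lemma V_weighted_bound:
  assumes u: "integrable J u" and v: "integrable J v" and w: "integrable J w"
    and w_nonneg: "\<And>s. s \<in> {t0..T} \<Longrightarrow> 0 \<le> w s" and m: "0 \<le> m"
    and bound: "\<And>s. s \<in> {t0..T} \<Longrightarrow> norm (u s - v s) \<le> w s + m * weight s"
    and t: "t \<in> {t0..T}"
  shows "norm (V u t - V v t) \<le> L * (LINT s|J. w s) + m / 2 * weight t"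
proof -
  have sub: "integrable (lebesgue_on {t0..t}) f" if "integrable J f" for f :: "real \<Rightarrow> 'c::euclidean_space"
    by (rule integrable_subinterval[OF that]) (use t in auto)
  have weight: "integrable (lebesgue_on {t0..t}) weight"
    by (intro continuous_imp_integrable_real continuous_intros)
  have "norm (V u t - V v t) \<le> L * (LINT s|lebesgue_on {t0..t}. norm (u s - v s))"
    using u v t by (intro V_lipschitz) auto
  also have "(LINT s|lebesgue_on {t0..t}. norm (u s - v s))
      \<le> (LINT s|lebesgue_on {t0..t}. w s + m * weight s)"
  proof (rule integral_mono)
    show "integrable (lebesgue_on {t0..t}) (\<lambda>s. norm (u s - v s))"
      by (intro integrable_norm sub Bochner_Integration.integrable_diff u v)
    show "integrable (lebesgue_on {t0..t}) (\<lambda>s. w s + m * weight s)"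
      using sub[OF w] weight by simp
  qed (use t bound in auto)
  also have "\<dots> = (LINT s|lebesgue_on {t0..t}. w s) + m * (LINT s|lebesgue_on {t0..t}. weight s)"
    using sub[OF w] weight by simp
  also have "\<dots> \<le> (LINT s|J. w s) + m * (weight t / (2 * L))"
    using t L_pos m w w_nonneg
    by (intro add_mono mult_left_mono lebesgue_on_integral_mono_interval lebesgue_on_integral_exp_le)
      auto
  finally have "norm (V u t - V v t) \<le> L * ((LINT s|J. w s) + m * (weight t / (2 * L)))"
    using L_pos by simp
  then show ?thesis
    using L_pos by (simp add: distrib_left)
qed

text \<open>Banach's theorem for bounded continuous functions on the line. The weight yields a
  contraction on the whole interval at once, so no solutions on short intervals have to be
  glued.\<close>

lemma ex_continuous_solution:
  assumes g: "integrable J g"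
  obtains z where "continuous_on {t0..T} z" "\<And>t. t \<in> {t0..T} \<Longrightarrow> z t = V (\<lambda>s. g s + z s) t"
proof -
  define c where "c t = max t0 (min t T)" for t
  have c: "c t \<in> {t0..T}" for t
    using interval by (auto simp: c_def)
  have c_id: "c t = t" if "t \<in> {t0..T}" for t
    using that by (auto simp: c_def)
  have contc: "continuous_on UNIV c"
    unfolding c_def by (intro continuous_intros)
  \<comment> \<open>Iterate on \<open>y = z / weight\<close>, extended constantly beyond the interval by \<open>c\<close>, so that the
    Bielecki norm of \<open>z\<close> becomes the sup norm of \<open>y\<close>.\<close>
  define p :: "(real \<Rightarrow>\<^sub>C 'b) \<Rightarrow> real \<Rightarrow> 'b" where "p y s = g s + weight s *\<^sub>R y s" for y s
  have p: "integrable J (p y)" for y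
    unfolding p_def
    by (intro Bochner_Integration.integrable_add g continuous_imp_integrable_real L2_fun_imp_integrable[OF finite_J]
        continuous_in_L2_fun continuous_intros continuous_on_apply_bcontfun)
  define q where "q y t = V (p y) t /\<^sub>R weight t" for y t
  have q: "continuous_on {t0..T} (q y)" for y
    unfolding q_def by (intro continuous_intros continuous_V p) auto
  have "q y \<circ> c \<in> bcontfun" for y
  proof -
    have "bounded (q y ` {t0..T})"
      by (intro compact_imp_bounded compact_continuous_image q) simp
    then have "bounded (range (q y \<circ> c))"
      by (rule bounded_subset) (use c in auto)
    moreover have "continuous_on UNIV (q y \<circ> c)"
      by (rule continuous_on_compose[OF contc continuous_on_subset[OF q]]) (use c in auto)
    ultimately show ?thesis by (simp add: bcontfun_def)
  qed
  then have Bcontfun_q: "apply_bcontfun (Bcontfun (q y \<circ> c)) = q y \<circ> c" for y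
    by (rule Bcontfun_inverse)
  have "dist (Bcontfun (q y \<circ> c)) (Bcontfun (q y' \<circ> c)) \<le> 1/2 * dist y y'" for y y'
  proof (rule dist_bound)
    fix t
    have "norm (V (p y) (c t) - V (p y') (c t)) \<le> L * (LINT s|J. 0) + dist y y' / 2 * weight (c t)"
    proof (rule V_weighted_bound[OF p p])
      fix s
      have "norm (p y s - p y' s) = dist (y s) (y' s) * weight s"
        by (simp add: p_def dist_norm mult.commute flip: scaleR_diff_right)
      also have "\<dots> \<le> dist y y' * weight s"
        by (intro mult_right_mono dist_bounded) auto
      finally show "norm (p y s - p y' s) \<le> 0 + dist y y' * weight s" by simp
    qed (use c in auto)
    then have "norm (V (p y) (c t) - V (p y') (c t)) / weight (c t) \<le> 1/2 * dist y y'"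
      by (simp add: pos_divide_le_eq)
    moreover have "dist (Bcontfun (q y \<circ> c) t) (Bcontfun (q y' \<circ> c) t)
        = norm (V (p y) (c t) - V (p y') (c t)) / weight (c t)"
      by (simp add: Bcontfun_q q_def dist_norm divide_inverse mult.commute flip: scaleR_diff_right)
    ultimately show "dist (Bcontfun (q y \<circ> c) t) (Bcontfun (q y' \<circ> c) t) \<le> 1/2 * dist y y'"
      by (simp only:)
  qed
  then have "\<exists>!y. Bcontfun (q y \<circ> c) = y"
    by (intro banach_fix_type[of "1/2"]) auto
  then obtain y where y: "Bcontfun (q y \<circ> c) = y" by blast
  define z where "z s = weight s *\<^sub>R y s" for s
  have "z t = V (\<lambda>s. g s + z s) t" if "t \<in> {t0..T}" for t
  proof -
    \<comment> \<open>On the interval \<open>c\<close> is the identity, so the fixed point equation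
      loses its extension.\<close>
    have "y t = q y t"
      using Bcontfun_q[of y] c_id[OF that] unfolding y by simp
    then show ?thesis
      by (simp add: z_def q_def p_def[abs_def])
  qed
  moreover have "continuous_on {t0..T} z"
    unfolding z_def by (intro continuous_intros continuous_on_apply_bcontfun)
  ultimately show ?thesis by (rule that[rotated])
qed

text \<open>Evaluate the weighted bound at a point \<open>x\<close> where \<open>|z - z'| / weight\<close> attains its maximum.\<close>

lemma continuous_solution_stable:
  assumes g: "integrable J g" "integrable J g'"
    and z: "continuous_on {t0..T} z" "continuous_on {t0..T} z'"
    and eq: "\<And>t. t \<in> {t0..T} \<Longrightarrow> z t = V (\<lambda>s. g s + z s) t"
      "\<And>t. t \<in> {t0..T} \<Longrightarrow> z' t = V (\<lambda>s. g' s + z' s) t"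
    and t: "t \<in> {t0..T}"
  shows "norm (z t - z' t) \<le> 2 * L * weight T * (LINT s|J. norm (g s - g' s))"
proof -
  let ?I = "LINT s|J. norm (g s - g' s)"
  let ?r = "\<lambda>s. norm (z s - z' s) / weight s"
  have I: "0 \<le> ?I" by simp
  have "continuous_on {t0..T} ?r"
    using z by (intro continuous_intros) auto
  then obtain x where x: "x \<in> {t0..T}" "\<And>s. s \<in> {t0..T} \<Longrightarrow> ?r s \<le> ?r x"
    using continuous_attains_sup[of "{t0..T}" ?r] interval by auto
  define m where "m = ?r x"
  have m: "0 \<le> m" by (simp add: m_def)
  have le: "norm (z s - z' s) \<le> m * weight s" if "s \<in> {t0..T}" for s
    using x(2)[OF that] by (simp add: m_def pos_divide_le_eq)
  have int: "integrable J z" "integrable J z'"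
    using z by (auto intro!: L2_fun_imp_integrable[OF finite_J] continuous_in_L2_fun)
  have "norm (V (\<lambda>s. g s + z s) x - V (\<lambda>s. g' s + z' s) x) \<le> L * ?I + m / 2 * weight x"
  proof (rule V_weighted_bound)
    fix s assume s: "s \<in> {t0..T}"
    have "norm ((g s + z s) - (g' s + z' s)) \<le> norm (g s - g' s) + norm (z s - z' s)"
      using norm_triangle_ineq[of "g s - g' s" "z s - z' s"] by (simp add: algebra_simps)
    then show "norm ((g s + z s) - (g' s + z' s)) \<le> norm (g s - g' s) + m * weight s"
      using le[OF s] by simp
  qed (use g int m x in auto)
  \<comment> \<open>The left side is \<open>norm (z x - z' x)\<close>, by the choice of
    \<open>x\<close> and the two equations; half of it can now be absorbed.\<close>
  then have "m * weight x \<le> L * ?I + m / 2 * weight x"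
    using eq x(1) by (simp add: m_def)
  then have "m * weight x \<le> 2 * L * ?I" by simp
  \<comment> \<open>The weight is at least 1 on the interval, as \<open>x \<ge> t0\<close>.\<close>
  moreover have "m * 1 \<le> m * weight x"
    using m x(1) L_pos by (intro mult_left_mono) auto
  ultimately have "m \<le> 2 * L * ?I" by simp
  have "norm (z t - z' t) \<le> m * weight t" by (rule le[OF t])
  also have "\<dots> \<le> (2 * L * ?I) * weight T"
    using \<open>m \<le> 2 * L * ?I\<close> t L_pos I by (intro mult_mono) auto
  finally show ?thesis by (simp add: mult_ac)
qed

section \<open>Transfer to classes in L2\<close>

lemma volterra_L2_class:
  "u \<in> L2_fun J \<Longrightarrow> volterra t0 T \<phi> (L2_class J u) = L2_class J (V u)"
  by (simp add: volterra_class V_def[abs_def])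

lemma continuous_V_L2: "u \<in> L2_fun J \<Longrightarrow> continuous_on {t0..T} (V u)"
  by (intro continuous_V L2_fun_imp_integrable finite_J)

lemma V_in_L2_fun: "u \<in> L2_fun J \<Longrightarrow> V u \<in> L2_fun J"
  by (rule continuous_in_L2_fun[OF continuous_V_L2])

text \<open>The chain from L2 to L1 to the sup norm and back to L2 gives a Lipschitz bound; the
  first and the last passage each cost a factor \<open>?\<mu>\<close>.\<close>

lemma continuous_map_volterra:
  "continuous_map (L2_topology J) (L2_topology J) (volterra t0 T \<phi>)"
proof (rule continuous_map_L2_Lipschitz)
  let ?\<mu> = "sqrt (measure J (space J))"
  fix A B :: "(real \<Rightarrow> 'b) set"
  assume A: "A \<in> L2_space J"
  then obtain u where u: "u \<in> L2_fun J" "A = L2_class J u" by (rule L2_space_cases)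
  then show "volterra t0 T \<phi> A \<in> L2_space J"
    by (simp add: volterra_L2_class V_in_L2_fun L2_class_in_space)
  assume B: "B \<in> L2_space J"
  then obtain v where v: "v \<in> L2_fun J" "B = L2_class J v" by (rule L2_space_cases)
  have int: "integrable J u" "integrable J v"
    using u v by (auto intro: L2_fun_imp_integrable finite_J)
  have "norm (V u t - V v t) \<le> L * (?\<mu> * L2_dist J A B)" if t: "t \<in> {t0..T}" for t
  proof -
    have "norm (V u t - V v t) \<le> L * (LINT s|lebesgue_on {t0..t}. norm (u s - v s))"
      using int t by (intro V_lipschitz) auto
    also have "\<dots> \<le> L * (LINT s|J. norm (u s - v s))"
      using int t L_pos by (intro mult_left_mono lebesgue_on_integral_mono_interval) auto
    also have "\<dots> \<le> L * (?\<mu> * L2_dist J A B)"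
      using L_pos integral_norm_diff_le_L2_dist[OF finite_J u(1) v(1)] u v by simp
    finally show ?thesis .
  qed
  then have "L2_dist J (L2_class J (V u)) (L2_class J (V v)) \<le> ?\<mu> * (L * (?\<mu> * L2_dist J A B))"
    using u v L_pos Metric_space.nonneg[OF L2_Metric_space, of J A B]
    by (intro L2_dist_class_le finite_J V_in_L2_fun) auto
  then show "L2_dist J (volterra t0 T \<phi> A) (volterra t0 T \<phi> B) \<le> ?\<mu> * L * ?\<mu> * L2_dist J A B"
    using u v by (simp only: volterra_L2_class mult.assoc)
qed

text \<open>If \<open>z\<close> is the continuous solution for a representative \<open>g\<close>,
  then \<open>h = g + z\<close> has \<open>V h = z\<close> on the interval, hence
  \<open>h = g + V h\<close> there.\<close>

lemma ex_L2_solution: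
  assumes G: "G \<in> L2_space J"
  shows "\<exists>H \<in> L2_space J. H = L2_add J G (volterra t0 T \<phi> H)"
proof -
  obtain g where g: "g \<in> L2_fun J" "G = L2_class J g"
    using G by (rule L2_space_cases)
  obtain z where z: "continuous_on {t0..T} z" "\<And>t. t \<in> {t0..T} \<Longrightarrow> z t = V (\<lambda>s. g s + z s) t"
    using ex_continuous_solution[OF L2_fun_imp_integrable[OF finite_J g(1)]] by blast
  define h where "h s = g s + z s" for s
  have h: "h \<in> L2_fun J"
    unfolding h_def by (rule L2_fun_add[OF g(1) continuous_in_L2_fun[OF z(1)]])
  have "L2_add J G (volterra t0 T \<phi> (L2_class J h)) = L2_class J (\<lambda>s. g s + V h s)"
    using g h by (simp add: volterra_L2_class L2_add_class V_in_L2_fun)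
  also have "\<dots> = L2_class J h"
  proof (subst L2_class_eq_iff)
    have "g s + V h s = h s" if "s \<in> {t0..T}" for s
      using z(2)[OF that] by (simp add: h_def[abs_def])
    then show "AE s in J. g s + V h s = h s" by (intro AE_I2) simp
  qed (use g h in \<open>auto intro: L2_fun_add V_in_L2_fun\<close>)
  finally show ?thesis
    using h L2_class_in_space by (intro bexI[of _ "L2_class J h"]) auto
qed

text \<open>For representatives \<open>h\<close>, \<open>h'\<close> of the solutions,
  \<open>V h\<close> and \<open>V h'\<close> solve the continuous problem, so they are close in sup
  norm. The two factors \<open>?\<mu>\<close> combine to the measure of the interval, and the
  summand 1 comes from \<open>G\<close> and \<open>G'\<close> themselves.\<close>

lemma L2_solution_stable:
  assumes space: "G \<in> L2_space J" "G' \<in> L2_space J" "H \<in> L2_space J" "H' \<in> L2_space J"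
    and eq: "H = L2_add J G (volterra t0 T \<phi> H)" "H' = L2_add J G' (volterra t0 T \<phi> H')"
  shows "L2_dist J H H' \<le> (1 + 2 * L * weight T * measure J (space J)) * L2_dist J G G'"
proof -
  let ?\<mu> = "sqrt (measure J (space J))"
  obtain g g' h h' where g: "g \<in> L2_fun J" "G = L2_class J g" "g' \<in> L2_fun J" "G' = L2_class J g'"
    and h: "h \<in> L2_fun J" "H = L2_class J h" "h' \<in> L2_fun J" "H' = L2_class J h'"
    using space by (auto elim!: L2_space_cases)
  \<comment> \<open>Applying \<open>V\<close> to the almost everywhere equation
    \<open>k = f + V k\<close> produces an equation valid at every \<open>t\<close>, as the
    stability of continuous solutions demands.\<close>
  have V_fixed: "V k t = V (\<lambda>s. f s + V k s) t" if fk: "f \<in> L2_fun J" "k \<in> L2_fun J"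
    and eq: "L2_class J k = L2_add J (L2_class J f) (volterra t0 T \<phi> (L2_class J k))" 
    and t: "t \<in> {t0..T}" for f k t
  proof (rule V_cong_AE)
    have "L2_class J k = L2_class J (\<lambda>s. f s + V k s)"
      using eq fk by (simp add: volterra_L2_class L2_add_class V_in_L2_fun)
    then show "AE s in J. k s = f s + V k s"
      using fk by (simp add: L2_class_eq_iff L2_fun_add V_in_L2_fun)
  qed (use t in simp)
  let ?C = "2 * L * weight T"
  have "norm (V h t - V h' t) \<le> ?C * (?\<mu> * L2_dist J G G')" if t: "t \<in> {t0..T}" for t
  proof -
    have "norm (V h t - V h' t) \<le> ?C * (LINT s|J. norm (g s - g' s))"
      using g h eq t
      by (intro continuous_solution_stable L2_fun_imp_integrable finite_J continuous_V_L2 V_fixed) auto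
    also have "\<dots> \<le> ?C * (?\<mu> * L2_dist J G G')"
      using L_pos integral_norm_diff_le_L2_dist[OF finite_J g(1) g(3)] g by simp
    finally show ?thesis .
  qed
  then have "L2_dist J (volterra t0 T \<phi> H) (volterra t0 T \<phi> H')
      \<le> ?\<mu> * (?C * (?\<mu> * L2_dist J G G'))"
    unfolding h volterra_L2_class[OF h(1)] volterra_L2_class[OF h(3)]
    using h L_pos Metric_space.nonneg[OF L2_Metric_space, of J G G']
    by (intro L2_dist_class_le finite_J V_in_L2_fun) auto
  also have "\<dots> = ?C * measure J (space J) * L2_dist J G G'"
    by (simp add: mult_ac flip: real_sqrt_mult)
  finally have "L2_dist J (volterra t0 T \<phi> H) (volterra t0 T \<phi> H') \<le> \<dots>" .
  moreover have "L2_dist J H H'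
      \<le> L2_dist J G G' + L2_dist J (volterra t0 T \<phi> H) (volterra t0 T \<phi> H')"
  proof -
    have "volterra t0 T \<phi> H \<in> L2_space J" "volterra t0 T \<phi> H' \<in> L2_space J"
      using h by (auto simp: volterra_L2_class V_in_L2_fun L2_class_in_space)
    from L2_dist_add_le[OF space(1) this(1) space(2) this(2)] show ?thesis
      by (simp only: eq[symmetric])
  qed
  ultimately show ?thesis by (simp add: algebra_simps)
qed

end

theorem mainTheorem5:
  fixes t0 T :: real
    and \<phi> :: "real \<Rightarrow> real \<Rightarrow> real ^ 'n \<Rightarrow> real ^ 'n"
  assumes "t0 < T"
    and "continuous_on {(t, s, v). t0 \<le> s \<and> s \<le> t \<and> t \<le> T} (\<lambda>(t, s, v). \<phi> t s v)"
    and "\<exists>L::real. \<forall>t s v w. t0 \<le> s \<and> s \<le> t \<and> t \<le> T \<longrightarrow>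
           norm (\<phi> t s v - \<phi> t s w) \<le> L * norm (v - w)"
  shows "topological_vector_space.machine
           (L2_topology (lebesgue_on {t0..T})) (L2_add (lebesgue_on {t0..T}))
           TYPE('x) (volterra t0 T \<phi>)"
proof -
  obtain L where L: "\<And>t s v w. t0 \<le> s \<Longrightarrow> s \<le> t \<Longrightarrow> t \<le> T \<Longrightarrow>
      norm (\<phi> t s v - \<phi> t s w) \<le> L * norm (v - w)"
    using assms(3) by blast
  \<comment> \<open>The maximum with 1 secures a positive constant.\<close>
  interpret volterra_kernel t0 T "max L 1" \<phi>
  proof
    fix s t v w assume "t0 \<le> s" "s \<le> t" "t \<le> T"
    from L[OF this] show "norm (\<phi> t s v - \<phi> t s w) \<le> max L 1 * norm (v - w)"
      by (rule order_trans) (intro mult_right_mono, auto)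
  qed (use assms in auto)
  show ?thesis
    by (rule L2_machineI[OF continuous_map_volterra ex_L2_solution L2_solution_stable])
qed

end
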